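(* The mapping $[\mathsf{P}]\mapsto[\mathcal{A}_\mathsf{P}]$ is a well-defined order-embedding from $\big(\mathbb{P}_{\mathrm{lay}},\preccurlyeq_c\big)/\!\equiv_c$ into $\big(\mathbf{\Delta}^0_2(\mathcal{P}\omega),\leq_w\big)/\!\equiv_w$; i.e. for all $\mathsf{P},\mathsf{Q}\in\mathbb{P}_{\mathrm{lay}}$, $\mathcal{A}_\mathsf{P}\in\mathbf{\Delta}^0_2(\mathcal{P}\omega)$, and $\mathsf{P}\preccurlyeq_c\mathsf{Q}$ if and only if $\mathcal{A}_\mathsf{P}\leq_w\mathcal{A}_\mathsf{Q}$ (so in particular $\mathsf{P}\equiv_c\mathsf{Q}$ iff $\mathcal{A}_\mathsf{P}\equiv_w\mathcal{A}_\mathsf{Q}$).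
   Context: Scott domain: $\mathcal{P}\omega$ is the power set of $\omega$ with topology generated by $\mathcal{O}_F=\{x\subseteq\omega\mid F\subseteq x\}$, $F\subseteq\omega$ finite. Borel classes (Selivanov): $\mathbf{\Sigma}^0_1$ = open sets; $\mathbf{\Sigma}^0_2(\mathcal{P}\omega)$ = countable unions of sets $B\setminus B'$ with $B,B'$ open; $\mathbf{\Pi}^0_2$ = complements of $\mathbf{\Sigma}^0_2$ sets; $\mathbf{\Delta}^0_2=\mathbf{\Sigma}^0_2\cap\mathbf{\Pi}^0_2$. $\mathcal{A}\leq_w\mathcal{B}$ iff there is a continuous $f:\mathcal{P}\omega\to\mathcal{P}\omega$ with $f^{-1}[\mathcal{B}]=\mathcal{A}$; $\equiv_w$ is the induced equivalence, and the quotient is ordered by $[\mathcal{A}]\leq[\mathcal{B}]$ iff $\mathcal{A}\leq_w\mathcal{B}$. 2-colored posets: a triple $\mathsf{P}=(P,\leq_p,\mathrm{col}_p)$ with $\leq_p$ a partial order and $\mathrm{col}_p:P\to\{0,1\}$. A homomorphism $\varphi:\mathsf{P}\to\mathsf{Q}$ is a map with $p\leq_p p'\Rightarrow\varphi(p)\leq_q\varphi(p')$ and $\mathrm{col}_q(\varphi(p))=\mathrm{col}_p(p)$; $\mathsf{P}\preccurlyeq_c\mathsf{Q}$ means such a homomorphism exists, $\equiv_c$ is the induced equivalence, and the quotient is ordered accordingly. $\mathsf{P}\rightarrowtail_c\mathsf{Q}$ means there is an injective homomorphism $\varphi$ which preserves immediate predecessors: if $p_0$ is an immediate predecessor of $p_1$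 (i.e. $p_0<p_1$ with nothing strictly between), then $\varphi(p_0)$ is an immediate predecessor of $\varphi(p_1)$. Shrubs: a countable poset $(P,\leq_p)$ is a shrub if (1) there is no injective order-preserving map from $(\omega,\leq)$ into $P$; (2) every $p\in P$ has finitely many elements $\leq_p p$; (3) there is a $\leq_p$-minimal element, denoted $\bot$; (4) $P$ is bounded complete: every subset having an upper bound has a least upper bound (supremum). $\mathbb{P}_{\mathrm{lay}}$ (embeddable posets) is the class of countable 2-colored posets $\mathsf{P}$ whose underlying poset is a shrub and such that: (a) $\mathrm{col}_p(\bot)=0$; (b) every $\leq_p$-maximal element has color $1$; (c) none of the following 2-colored posets satisfies $\cdot\rightarrowtail_c\mathsf{P}$: $\vee^0_1$ (elements $a<b$, $a<c$, $b,c$ incomparable, $\mathrm{col}(a)=1$, $\mathrm{col}(b)=\mathrm{col}(c)=0$), $\wedge^1_0$ (elements $a<c$, $b<c$, $a,b$ incomparable, $\mathrm{col}(c)=1$, $\mathrm{col}(a)=\mathrm{col}(b)=0$), and $\mid^1_1$ (elements $a<b$, both of color $1$). The set $\mathcal{A}_\mathsf{P}$: identify the underlying set of $\mathsf{P}$ with some $\alpha\in\omega\cup\{\omega\}$ (so elements are natural numbers). Define the labeling $l_p:P\to\mathcal{P}_{<\omega}(\omega)$ by $l_p(\bot)=\emptyset$ and $l_p(n)=\{k\in P\mid k\leq_p n\}$ for $n\neq\bot$. Then $\mathcal{A}_\mathsf{P}=\{l_p(p)\mid p\in P,\ \mathrm{col}_p(p)=1\}\subseteq\mathcal{P}\omega$.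 *)

theory Defs
  imports "HOL-Analysis.Analysis"
begin

section \<open>The Scott domain and Wadge reducibility\<close>

definition scott :: "nat set topology" where
  "scott = topology_generated_by {{x. F \<subseteq> x} | F. finite F}"

definition Sigma02 :: "nat set set set" where
  "Sigma02 = {A. \<exists>B B' :: nat \<Rightarrow> nat set set.
     (\<forall>n. openin scott (B n)) \<and> (\<forall>n. openin scott (B' n)) \<and> A = (\<Union>n. B n - B' n)}"

definition Pi02 :: "nat set set set" where
  "Pi02 = {A. - A \<in> Sigma02}"

definition Delta02 :: "nat set set set" where
  "Delta02 = Sigma02 \<inter> Pi02"

definition wadge_le :: "nat set set \<Rightarrow> nat set set \<Rightarrow> bool" (infix \<open>\<le>\<^sub>w\<close> 50) where
  "A \<le>\<^sub>w B \<longleftrightarrow> (\<exists>f. continuous_map scott scott f \<and> f -` B = A)"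

definition wadge_eq :: "nat set set \<Rightarrow> nat set set \<Rightarrow> bool" (infix \<open>\<equiv>\<^sub>w\<close> 50) where
  "A \<equiv>\<^sub>w B \<longleftrightarrow> A \<le>\<^sub>w B \<and> B \<le>\<^sub>w A"

section \<open>2-colored posets\<close>

text \<open>The colors 0 and 1 are represented by \<^const>\<open>False\<close> and \<^const>\<open>True\<close>.
  Colors outside of the carrier are irrelevant.\<close>

record 'a cposet =
  elems :: "'a set"
  leq :: "'a rel"
  col :: "'a \<Rightarrow> bool"

definition cposet :: "'a cposet \<Rightarrow> bool" where
  "cposet P \<longleftrightarrow> partial_order_on (elems P) (leq P)"

definition is_hom :: "'a cposet \<Rightarrow> 'b cposet \<Rightarrow> ('a \<Rightarrow> 'b) \<Rightarrow> bool" where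
  "is_hom P Q \<phi> \<longleftrightarrow>
     (\<forall>p\<in>elems P. \<phi> p \<in> elems Q) \<and>
     (\<forall>p p'. (p, p') \<in> leq P \<longrightarrow> (\<phi> p, \<phi> p') \<in> leq Q) \<and>
     (\<forall>p\<in>elems P. col Q (\<phi> p) = col P p)"

definition hom_le :: "'a cposet \<Rightarrow> 'b cposet \<Rightarrow> bool" (infix \<open>\<preceq>\<^sub>c\<close> 50) where
  "P \<preceq>\<^sub>c Q \<longleftrightarrow> (\<exists>\<phi>. is_hom P Q \<phi>)"

definition hom_eq :: "'a cposet \<Rightarrow> 'b cposet \<Rightarrow> bool" (infix \<open>\<equiv>\<^sub>c\<close> 50) where
  "P \<equiv>\<^sub>c Q \<longleftrightarrow> P \<preceq>\<^sub>c Q \<and> Q \<preceq>\<^sub>c P"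

definition strictly_below :: "'a cposet \<Rightarrow> 'a \<Rightarrow> 'a \<Rightarrow> bool" where
  "strictly_below P p q \<longleftrightarrow> (p, q) \<in> leq P \<and> p \<noteq> q"

definition imm_pred :: "'a cposet \<Rightarrow> 'a \<Rightarrow> 'a \<Rightarrow> bool" where
  "imm_pred P p q \<longleftrightarrow>
     strictly_below P p q \<and> (\<nexists>r. strictly_below P p r \<and> strictly_below P r q)"

definition hom_inj_le :: "'a cposet \<Rightarrow> 'b cposet \<Rightarrow> bool" (infix \<open>\<rightarrowtail>\<^sub>c\<close> 50) where
  "P \<rightarrowtail>\<^sub>c Q \<longleftrightarrow>
     (\<exists>\<phi>. is_hom P Q \<phi> \<and> inj_on \<phi> (elems P) \<and>
          (\<forall>p q. imm_pred P p q \<longrightarrow> imm_pred Q (\<phi> p) (\<phi> q)))"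

section \<open>Shrubs\<close>

definition is_minimal :: "'a cposet \<Rightarrow> 'a \<Rightarrow> bool" where
  "is_minimal P b \<longleftrightarrow> b \<in> elems P \<and> (\<forall>p\<in>elems P. (p, b) \<in> leq P \<longrightarrow> p = b)"

definition is_maximal :: "'a cposet \<Rightarrow> 'a \<Rightarrow> bool" where
  "is_maximal P m \<longleftrightarrow> m \<in> elems P \<and> (\<forall>p\<in>elems P. (m, p) \<in> leq P \<longrightarrow> p = m)"

definition is_upper_bound :: "'a cposet \<Rightarrow> 'a set \<Rightarrow> 'a \<Rightarrow> bool" where
  "is_upper_bound P X u \<longleftrightarrow> u \<in> elems P \<and> (\<forall>x\<in>X. (x, u) \<in> leq P)"

definition is_supremum :: "'a cposet \<Rightarrow> 'a set \<Rightarrow> 'a \<Rightarrow> bool" where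
  "is_supremum P X s \<longleftrightarrow>
     is_upper_bound P X s \<and> (\<forall>u. is_upper_bound P X u \<longrightarrow> (s, u) \<in> leq P)"

definition bounded_complete :: "'a cposet \<Rightarrow> bool" where
  "bounded_complete P \<longleftrightarrow>
     (\<forall>X\<subseteq>elems P. (\<exists>u. is_upper_bound P X u) \<longrightarrow> (\<exists>s. is_supremum P X s))"

definition shrub :: "'a cposet \<Rightarrow> bool" where
  "shrub P \<longleftrightarrow>
     cposet P \<and> countable (elems P) \<and>
     (\<nexists>f :: nat \<Rightarrow> 'a. inj f \<and> range f \<subseteq> elems P \<and> (\<forall>m n. m \<le> n \<longrightarrow> (f m, f n) \<in> leq P)) \<and>
     (\<forall>p\<in>elems P. finite {q \<in> elems P. (q, p) \<in> leq P}) \<and>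
     (\<exists>b. is_minimal P b) \<and>
     bounded_complete P"

text \<open>In a shrub the minimal element is unique (and is the least element): bounded
  completeness also applies to the empty subset.\<close>

definition shrub_bot :: "'a cposet \<Rightarrow> 'a" where
  "shrub_bot P = (THE b. is_minimal P b)"

section \<open>Embeddable posets\<close>

definition vee01 :: "nat cposet" where
  "vee01 = \<lparr>elems = {0, 1, 2}, leq = Id_on {0, 1, 2} \<union> {(0, 1), (0, 2)}, col = (\<lambda>n. n = 0)\<rparr>"

definition wedge10 :: "nat cposet" where
  "wedge10 = \<lparr>elems = {0, 1, 2}, leq = Id_on {0, 1, 2} \<union> {(0, 2), (1, 2)}, col = (\<lambda>n. n = 2)\<rparr>"

definition bar11 :: "nat cposet" where
  "bar11 = \<lparr>elems = {0, 1}, leq = Id_on {0, 1} \<union> {(0, 1)}, col = (\<lambda>n. True)\<rparr>"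

definition P_lay :: "'a cposet set" where
  "P_lay = {P. shrub P \<and>
     \<not> col P (shrub_bot P) \<and>
     (\<forall>m. is_maximal P m \<longrightarrow> col P m) \<and>
     \<not> vee01 \<rightarrowtail>\<^sub>c P \<and> \<not> wedge10 \<rightarrowtail>\<^sub>c P \<and> \<not> bar11 \<rightarrowtail>\<^sub>c P}"

section \<open>The set associated with a colored poset\<close>

text \<open>An identification of the carrier with some \<open>\<alpha> \<in> \<omega> \<union> {\<omega>}\<close>, where a natural number
  is the set of its predecessors.\<close>

definition identification :: "'a cposet \<Rightarrow> ('a \<Rightarrow> nat) \<Rightarrow> bool" where
  "identification P e \<longleftrightarrow>
     (\<exists>\<alpha>. (\<alpha> = UNIV \<or> (\<exists>n. \<alpha> = {..<n})) \<and> bij_betw e (elems P) \<alpha>)"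

definition label :: "'a cposet \<Rightarrow> ('a \<Rightarrow> nat) \<Rightarrow> 'a \<Rightarrow> nat set" where
  "label P e p = (if p = shrub_bot P then {} else e ` {k \<in> elems P. (k, p) \<in> leq P})"

definition A_set :: "'a cposet \<Rightarrow> ('a \<Rightarrow> nat) \<Rightarrow> nat set set" where
  "A_set P e = {label P e p | p. p \<in> elems P \<and> col P p}"

section \<open>The quotient orders\<close>

definition lay_equiv :: "'a cposet rel" where
  "lay_equiv = {(P, Q). P \<in> P_lay \<and> Q \<in> P_lay \<and> P \<equiv>\<^sub>c Q}"

definition lay_class_le :: "'a cposet set \<Rightarrow> 'a cposet set \<Rightarrow> bool" where
  "lay_class_le X Y \<longleftrightarrow> (\<exists>P\<in>X. \<exists>Q\<in>Y. P \<preceq>\<^sub>c Q)"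

definition delta_equiv :: "nat set set rel" where
  "delta_equiv = {(A, B). A \<in> Delta02 \<and> B \<in> Delta02 \<and> A \<equiv>\<^sub>w B}"

definition delta_class_le :: "nat set set set \<Rightarrow> nat set set set \<Rightarrow> bool" where
  "delta_class_le X Y \<longleftrightarrow> (\<exists>A\<in>X. \<exists>B\<in>Y. A \<le>\<^sub>w B)"

end

theory Submission
  imports Defs
begin

text \<open>
  A point of color 1 has exactly one immediate predecessor, and that predecessor has color 0
  (exclusion of \<open>bar11\<close> and \<open>wedge10\<close>). Call \<open>x \<subseteq> \<omega>\<close> bounded if it is contained in
  the principal ideal of some point, and let \<open>t\<close> be the least such point. Sending \<open>x\<close> to \<open>t\<close>,
  or to the immediate predecessor of \<open>t\<close> when \<open>t\<close> has color 1 and \<open>x\<close> is not its label, is a monotone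
  left inverse of the labeling whose value has color 1 exactly when \<open>x \<in> A\<^sub>P\<close>. Since the
  unbounded sets form an open set containing all infinite sets, a homomorphism \<open>\<phi>\<close> extends to the
  continuous map \<open>label \<circ> \<phi> \<circ> core\<close>, with value \<open>\<omega>\<close> on the unbounded sets. Conversely,
  a reduction \<open>f\<close> yields the homomorphism \<open>core \<circ> f \<circ> label\<close>: every point lies below a maximal
  one, which has color 1, so \<open>f\<close> takes labels to bounded sets.
\<close>

section \<open>The Scott topology\<close>

lemma topspace_scott [simp]: "topspace scott = UNIV"
  unfolding scott_def by auto

lemma openin_scott_basic: "finite F \<Longrightarrow> openin scott {x. F \<subseteq> x}"
  unfolding scott_def by (rule topology_generated_by_Basis) auto

text \<open>Finite sets are closed under union, so the local description survives intersections
  while the topology is generated. Conversely, such a \<open>U\<close> is the union of the basic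
  sets inside it.\<close>

lemma openin_scott_iff:
  "openin scott U \<longleftrightarrow> (\<forall>x\<in>U. \<exists>F. finite F \<and> F \<subseteq> x \<and> {y. F \<subseteq> y} \<subseteq> U)"
proof
  assume "openin scott U"
  then have "generate_topology_on {{x. F \<subseteq> x} | F. finite F} U"
    unfolding scott_def by (rule openin_topology_generated_by)
  then show "\<forall>x\<in>U. \<exists>F. finite F \<and> F \<subseteq> x \<and> {y. F \<subseteq> y} \<subseteq> U"
  proof induction
    case Empty
    then show ?case by simp
  next
    case (Int a b)
    show ?case
    proof
      fix x assume "x \<in> a \<inter> b"
      then obtain F G where "finite F" "F \<subseteq> x" "{y. F \<subseteq> y} \<subseteq> a" "finite G" "G \<subseteq> x" "{y. G \<subseteq> y} \<subseteq> b"
        using Int.IH by (metis IntE)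
      then show "\<exists>F. finite F \<and> F \<subseteq> x \<and> {y. F \<subseteq> y} \<subseteq> a \<inter> b"
        by (intro exI[of _ "F \<union> G"]) auto
    qed
  next
    case (UN K)
    then show ?case by (meson Union_iff Union_upper subset_trans)
  next
    case (Basis s)
    then show ?case by auto
  qed
next
  assume *: "\<forall>x\<in>U. \<exists>F. finite F \<and> F \<subseteq> x \<and> {y. F \<subseteq> y} \<subseteq> U"
  have "U = \<Union> {{x. F \<subseteq> x} | F. finite F \<and> {x. F \<subseteq> x} \<subseteq> U}"
  proof (intro equalityI subsetI)
    fix x assume "x \<in> U"
    then obtain F where "finite F" "F \<subseteq> x" "{y. F \<subseteq> y} \<subseteq> U"
      using bspec[OF * \<open>x \<in> U\<close>] by (elim exE conjE)
    then show "x \<in> \<Union> {{x. F \<subseteq> x} | F. finite F \<and> {x. F \<subseteq> x} \<subseteq> U}"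
      by (intro UnionI[of "{y. F \<subseteq> y}"] CollectI exI[of _ F]) auto
  qed auto
  moreover have "openin scott (\<Union> {{x. F \<subseteq> x} | F. finite F \<and> {x. F \<subseteq> x} \<subseteq> U})"
    by (rule openin_Union) (auto intro: openin_scott_basic)
  ultimately show "openin scott U" by simp
qed

text \<open>Scott open sets are upward closed, so the preimage of the open set of all sets
  containing \<open>n\<close> contains \<open>y\<close> along with \<open>x\<close>.\<close>

lemma continuous_map_scott_mono:
  assumes "continuous_map scott scott f" "x \<subseteq> y"
  shows "f x \<subseteq> f y"
proof
  fix n assume n: "n \<in> f x"
  have "openin scott {x \<in> topspace scott. f x \<in> {z. {n} \<subseteq> z}}"
    using assms(1) openin_scott_basic[of "{n}"] unfolding continuous_map_def by blast
  then have "openin scott {x. n \<in> f x}" by simp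
  then show "n \<in> f y" using n assms(2) unfolding openin_scott_iff by blast
qed

text \<open>Once \<open>f F\<close> lies in an open set, so do the values at all supersets of
  \<open>F\<close>, since \<open>f\<close> is monotone and open sets are upward closed.\<close>

lemma continuous_map_scottI:
  assumes mono: "\<And>x y. x \<subseteq> y \<Longrightarrow> f x \<subseteq> f y"
    and fin: "\<And>x. \<exists>F. finite F \<and> F \<subseteq> x \<and> f F = f x"
  shows "continuous_map scott scott f"
  unfolding continuous_map_def
proof (intro conjI allI impI)
  fix U assume U: "openin scott U"
  have "\<exists>F. finite F \<and> F \<subseteq> x \<and> {y. F \<subseteq> y} \<subseteq> {x. f x \<in> U}" if x: "f x \<in> U" for x
  proof -
    obtain F where F: "finite F" "F \<subseteq> x" "f F = f x" using fin by blast
    have "f y \<in> U" if "F \<subseteq> y" for y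
      using mono[OF that] F(3) x U unfolding openin_scott_iff by (metis (mono_tags) mem_Collect_eq subset_iff)
    then show ?thesis using F by blast
  qed
  then show "openin scott {x \<in> topspace scott. f x \<in> U}"
    unfolding openin_scott_iff by auto
qed simp

section \<open>The second level of the Borel hierarchy\<close>

lemma Sigma02_openI: "openin scott U \<Longrightarrow> U \<in> Sigma02"
  unfolding Sigma02_def by (rule CollectI, rule exI[of _ "\<lambda>_. U"], rule exI[of _ "\<lambda>_. {}"]) auto

lemma Sigma02_Un:
  assumes "A \<in> Sigma02" "B \<in> Sigma02"
  shows "A \<union> B \<in> Sigma02"
proof -
  obtain A1 A2 :: "nat \<Rightarrow> nat set set" where A: "\<forall>n. openin scott (A1 n)"
    "\<forall>n. openin scott (A2 n)" "A = (\<Union>n. A1 n - A2 n)"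
    using assms(1) unfolding Sigma02_def by blast
  obtain B1 B2 :: "nat \<Rightarrow> nat set set" where B: "\<forall>n. openin scott (B1 n)"
    "\<forall>n. openin scott (B2 n)" "B = (\<Union>n. B1 n - B2 n)"
    using assms(2) unfolding Sigma02_def by blast
  \<comment> \<open>The two sequences of differences are interleaved: even indices for
    \<open>A\<close>, odd ones for \<open>B\<close>.\<close>
  define C1 where "C1 n = (if even n then A1 (n div 2) else B1 (n div 2))" for n
  define C2 where "C2 n = (if even n then A2 (n div 2) else B2 (n div 2))" for n
  have "x \<in> (\<Union>n. C1 n - C2 n)" if "x \<in> A1 n - A2 n" for x n
    using that by (intro UN_I[of "2 * n"]) (auto simp: C1_def C2_def)
  moreover have "x \<in> (\<Union>n. C1 n - C2 n)" if "x \<in> B1 n - B2 n" for x n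
    using that by (intro UN_I[of "2 * n + 1"]) (auto simp: C1_def C2_def)
  ultimately have "A \<union> B = (\<Union>n. C1 n - C2 n)"
    unfolding A(3) B(3) by (auto simp: C1_def C2_def split: if_splits)
  moreover have "openin scott (C1 n)" "openin scott (C2 n)" for n
    using A B unfolding C1_def C2_def by auto
  ultimately show ?thesis unfolding Sigma02_def by blast
qed

text \<open>There are only countably many finite sets of naturals, and the singleton of a finite set
  is a difference of open sets: all its supersets minus the proper ones.\<close>

lemma Sigma02_finite_sets:
  assumes fin: "\<And>x. x \<in> A \<Longrightarrow> finite x"
  shows "A \<in> Sigma02"
\<comment> \<open>The empty family is treated apart because it is not the range of a
  sequence.\<close>
proof (cases "A = {}")
  case True
  then show ?thesis by (simp add: Sigma02_openI)
next
  case False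
  have "countable A"
    using fin by (intro countable_subset[OF _ countable_Collect_finite]) auto
  then obtain a :: "nat \<Rightarrow> nat set" where a: "range a = A"
    using False by (metis range_from_nat_into)
  define U where "U n = {x. a n \<subseteq> x}" for n
  define V where "V n = (\<Union>k\<in>- a n. {x. insert k (a n) \<subseteq> x})" for n
  have fa: "finite (a n)" for n using a fin by blast
  then have "openin scott (U n)" for n unfolding U_def by (rule openin_scott_basic)
  moreover have "openin scott (V n)" for n
    unfolding V_def using fa by (intro openin_Union) (auto intro!: openin_scott_basic simp del: insert_subset)
  moreover have "U n - V n = {a n}" for n unfolding U_def V_def by auto
  then have "A = (\<Union>n. U n - V n)" using a by auto
  ultimately show ?thesis unfolding Sigma02_def by blast
qed

lemma wadge_le_trans:
  assumes "A \<le>\<^sub>w B" "B \<le>\<^sub>w C"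
  shows "A \<le>\<^sub>w C"
proof -
  obtain f g where "continuous_map scott scott f" "f -` B = A"
    "continuous_map scott scott g" "g -` C = B"
    using assms unfolding wadge_le_def by blast
  then have "continuous_map scott scott (g \<circ> f)" "(g \<circ> f) -` C = A"
    by (auto simp: continuous_map_compose)
  then show ?thesis unfolding wadge_le_def by blast
qed

lemma wadge_eq_refl: "A \<equiv>\<^sub>w A"
  unfolding wadge_eq_def wadge_le_def by (auto intro: exI[of _ id])

lemma hom_le_trans:
  assumes "P \<preceq>\<^sub>c Q" "Q \<preceq>\<^sub>c R"
  shows "P \<preceq>\<^sub>c R"
proof -
  obtain \<phi> \<psi> where "is_hom P Q \<phi>" "is_hom Q R \<psi>"
    using assms unfolding hom_le_def by blast
  then have "is_hom P R (\<psi> \<circ> \<phi>)" unfolding is_hom_def by simp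
  then show ?thesis unfolding hom_le_def by blast
qed

lemma hom_eq_refl: "P \<equiv>\<^sub>c P"
  unfolding hom_eq_def hom_le_def is_hom_def by (auto intro: exI[of _ id])

section \<open>Embeddable posets\<close>

locale lay_poset =
  fixes P :: "'a cposet" and e :: "'a \<Rightarrow> nat"
  assumes lay: "P \<in> P_lay" and inj: "inj_on e (elems P)"
begin

abbreviation le :: "'a \<Rightarrow> 'a \<Rightarrow> bool" (infix \<open>\<sqsubseteq>\<close> 50) where
  "p \<sqsubseteq> q \<equiv> (p, q) \<in> leq P"

abbreviation carrier :: "'a set" where
  "carrier \<equiv> elems P"

abbreviation bot :: 'a where
  "bot \<equiv> shrub_bot P"

section \<open>Order and finiteness in a shrub\<close>

lemma is_shrub: "shrub P"
  using lay unfolding P_lay_def by simp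

lemma partial_order: "partial_order_on carrier (leq P)"
  using is_shrub unfolding shrub_def cposet_def by simp

lemma le_carrier: "p \<sqsubseteq> q \<Longrightarrow> p \<in> carrier \<and> q \<in> carrier"
  using partial_order_onD(4)[OF partial_order] by blast

lemma le_refl: "p \<in> carrier \<Longrightarrow> p \<sqsubseteq> p"
  using partial_order_onD(1)[OF partial_order] by (simp add: refl_on_def)

lemma le_trans: "p \<sqsubseteq> q \<Longrightarrow> q \<sqsubseteq> r \<Longrightarrow> p \<sqsubseteq> r"
  using partial_order_onD(2)[OF partial_order] by (meson transD)

lemma le_antisym: "p \<sqsubseteq> q \<Longrightarrow> q \<sqsubseteq> p \<Longrightarrow> p = q"
  using partial_order_onD(3)[OF partial_order] by (meson antisymD)

lemma supremum_exists:
  assumes "X \<subseteq> carrier" "u \<in> carrier" "\<And>x. x \<in> X \<Longrightarrow> x \<sqsubseteq> u"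
  obtains s where "s \<in> carrier" "\<And>x. x \<in> X \<Longrightarrow> x \<sqsubseteq> s"
    "\<And>v. v \<in> carrier \<Longrightarrow> (\<And>x. x \<in> X \<Longrightarrow> x \<sqsubseteq> v) \<Longrightarrow> s \<sqsubseteq> v"
proof -
  have "is_upper_bound P X u" using assms unfolding is_upper_bound_def by blast
  then obtain s where "is_supremum P X s"
    using is_shrub assms(1) unfolding shrub_def bounded_complete_def by blast
  then show ?thesis using that unfolding is_supremum_def is_upper_bound_def by blast
qed

text \<open>The empty set has an upper bound, so bounded completeness provides its supremum. This is
  a least element, hence the only minimal one.\<close>

lemma bot_least: "bot \<in> carrier" "p \<in> carrier \<Longrightarrow> bot \<sqsubseteq> p"
proof -
  obtain b where b: "is_minimal P b" using is_shrub unfolding shrub_def by blast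
  then have "b \<in> carrier" unfolding is_minimal_def by blast
  from supremum_exists[OF _ this, of "{}"] obtain s
    where s: "s \<in> carrier" "\<And>v. v \<in> carrier \<Longrightarrow> s \<sqsubseteq> v" by auto
  have min: "c = s" if "is_minimal P c" for c
    using s that unfolding is_minimal_def by auto
  have "bot = s"
    unfolding shrub_bot_def
    by (rule the_equality) (use b min in blast)+
  then show "bot \<in> carrier" "p \<in> carrier \<Longrightarrow> bot \<sqsubseteq> p" using s by auto
qed

lemma col_bot: "\<not> col P bot"
  using lay unfolding P_lay_def by simp

lemma finite_ideal: "finite {k \<in> carrier. k \<sqsubseteq> p}"
  using is_shrub le_carrier unfolding shrub_def
  by (cases "p \<in> carrier") (auto intro: finite_subset[of _ "{}"])

text \<open>Repeated strict ascent would yield an injective order-preserving map from \<omega>,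
  which a shrub excludes. The relation is reversed so that minimality for it means maximality in the
  order.\<close>

lemma wf_above: "wf {(q, p). strictly_below P p q}"
proof (rule ccontr)
  assume "\<not> wf {(q, p). strictly_below P p q}"
  then obtain f :: "nat \<Rightarrow> 'a" where f: "\<And>i. strictly_below P (f i) (f (Suc i))"
    unfolding wf_iff_no_infinite_down_chain by auto
  have lef: "f m \<sqsubseteq> f n" if "m \<le> n" for m n
    using that
  proof (induction n rule: dec_induct)
    case base
    then show ?case using f[of m] le_carrier le_refl unfolding strictly_below_def by blast
  next
    case (step n)
    then show ?case using f[of n] le_trans unfolding strictly_below_def by blast
  qed
  have "f m \<noteq> f n" if "m < n" for m n
    using lef[of "Suc m" n] f[of m] that le_antisym unfolding strictly_below_def by (metis Suc_leI)
  then have "inj f" by (metis injI linorder_neqE_nat)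
  moreover have "range f \<subseteq> carrier" using lef le_carrier by blast
  ultimately show False using is_shrub lef unfolding shrub_def by blast
qed

lemma exists_maximal:
  assumes "p \<in> S" "S \<subseteq> carrier"
  obtains m where "m \<in> S" "\<And>r. r \<in> S \<Longrightarrow> m \<sqsubseteq> r \<Longrightarrow> r = m"
proof -
  obtain m where "m \<in> S" "\<And>r. strictly_below P m r \<Longrightarrow> r \<notin> S"
    using wfE_min[OF wf_above assms(1)] by (metis case_prodI mem_Collect_eq)
  then show ?thesis using that unfolding strictly_below_def by blast
qed

text \<open>An element maximal in the cone above \<open>p\<close> is maximal in \<open>P\<close>,
  and maximal elements have color 1. This later forces a reduction to send labels to bounded
  sets.\<close>

lemma exists_col_above:
  assumes "p \<in> carrier"
  obtains q where "p \<sqsubseteq> q" "col P q"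
proof -
  obtain m where m: "m \<in> {q \<in> carrier. p \<sqsubseteq> q}"
    "\<And>r. r \<in> {q \<in> carrier. p \<sqsubseteq> q} \<Longrightarrow> m \<sqsubseteq> r \<Longrightarrow> r = m"
    using exists_maximal[of p "{q \<in> carrier. p \<sqsubseteq> q}"] assms le_refl by blast
  then have "is_maximal P m" unfolding is_maximal_def using le_trans by blast
  then show ?thesis using that m lay unfolding P_lay_def by blast
qed

section \<open>Immediate predecessors of points of color 1\<close>

text \<open>Otherwise \<open>q\<close> and \<open>p\<close> would form the image of
  \<open>bar11\<close> under a map that preserves its single pair of immediate neighbors.\<close>

lemma imm_pred_color:
  assumes "imm_pred P q p" "col P p"
  shows "\<not> col P q"
proof
  assume q: "col P q"
  define \<phi> where "\<phi> n = (if n = 0 then q else p)" for n :: nat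
  have qp: "q \<sqsubseteq> p" "q \<noteq> p" using assms unfolding imm_pred_def strictly_below_def by auto
  have "is_hom bar11 P \<phi>"
    using qp q assms le_carrier[OF qp(1)] le_refl unfolding is_hom_def bar11_def \<phi>_def by auto
  moreover have "inj_on \<phi> (elems bar11)"
    using qp unfolding bar11_def \<phi>_def by auto
  moreover have "imm_pred P (\<phi> a) (\<phi> b)" if "imm_pred bar11 a b" for a b
  proof -
    have "a = 0 \<and> b = 1"
      using that unfolding bar11_def imm_pred_def strictly_below_def by auto
    then show ?thesis using assms unfolding \<phi>_def by auto
  qed
  ultimately have "bar11 \<rightarrowtail>\<^sub>c P" unfolding hom_inj_le_def by blast
  then show False using lay unfolding P_lay_def by blast
qed

text \<open>Both have color 0 by \<open>imm_pred_color\<close>, so if they were distinct they would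
  yield a copy of \<open>wedge10\<close> with top \<open>p\<close>.\<close>

lemma imm_pred_unique:
  assumes "imm_pred P q p" "imm_pred P r p" "col P p"
  shows "q = r"
proof (rule ccontr)
  assume neq: "q \<noteq> r"
  define \<phi> where "\<phi> n = (if n = 0 then q else if n = 1 then r else p)" for n :: nat
  have c: "\<not> col P q" "\<not> col P r" using assms imm_pred_color by blast+
  have qp: "q \<sqsubseteq> p" "q \<noteq> p" "r \<sqsubseteq> p" "r \<noteq> p"
    using assms unfolding imm_pred_def strictly_below_def by auto
  have "is_hom wedge10 P \<phi>"
    using qp c assms le_carrier[OF qp(1)] le_carrier[OF qp(3)] le_refl
    unfolding is_hom_def wedge10_def \<phi>_def by auto
  moreover have "inj_on \<phi> (elems wedge10)"
    using qp neq unfolding wedge10_def \<phi>_def inj_on_def by auto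
  moreover have "imm_pred P (\<phi> a) (\<phi> b)" if "imm_pred wedge10 a b" for a b
  proof -
    have "(a = 0 \<or> a = 1) \<and> b = 2"
      using that unfolding wedge10_def imm_pred_def strictly_below_def by auto
    then show ?thesis using assms unfolding \<phi>_def by auto
  qed
  ultimately have "wedge10 \<rightarrowtail>\<^sub>c P" unfolding hom_inj_le_def by blast
  then show False using lay unfolding P_lay_def by blast
qed

text \<open>Meaningful for points of color 1 in the carrier, where exactly one immediate predecessor
  exists.\<close>

definition pred :: "'a \<Rightarrow> 'a" where
  "pred p = (THE q. imm_pred P q p)"

text \<open>Every point strictly below \<open>p\<close> lies under an immediate predecessor of
  \<open>p\<close>. As that is unique, \<open>pred p\<close> is the greatest point strictly below
  \<open>p\<close>; this is what makes \<open>core\<close> monotone.\<close>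

lemma pred:
  assumes "col P p" "p \<in> carrier"
  shows "pred p \<in> carrier" "pred p \<sqsubseteq> p" "\<not> col P (pred p)"
    "r \<sqsubseteq> p \<Longrightarrow> r \<noteq> p \<Longrightarrow> r \<sqsubseteq> pred p"
proof -
  have ex: "\<exists>m. imm_pred P m p \<and> r \<sqsubseteq> m" if r: "r \<sqsubseteq> p" "r \<noteq> p" for r
  proof -
    define S where "S = {m. r \<sqsubseteq> m \<and> strictly_below P m p}"
    have "r \<in> S" "S \<subseteq> carrier"
      using r le_carrier le_refl unfolding S_def strictly_below_def by blast+
    then obtain m where m: "m \<in> S" "\<And>s. s \<in> S \<Longrightarrow> m \<sqsubseteq> s \<Longrightarrow> s = m"
      using exists_maximal by blast
    then have "imm_pred P m p"
      using le_trans unfolding imm_pred_def S_def strictly_below_def by blast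
    then show ?thesis using m unfolding S_def by blast
  qed
  have predI: "pred p = m" if "imm_pred P m p" for m
    unfolding pred_def using that imm_pred_unique assms(1) by blast
  have "bot \<sqsubseteq> p" "bot \<noteq> p" using bot_least assms col_bot by auto
  then have "imm_pred P (pred p) p" using ex predI by metis
  then show "pred p \<in> carrier" "pred p \<sqsubseteq> p" "\<not> col P (pred p)"
    using imm_pred_color assms le_carrier unfolding imm_pred_def strictly_below_def by blast+
  show "r \<sqsubseteq> p \<Longrightarrow> r \<noteq> p \<Longrightarrow> r \<sqsubseteq> pred p" using ex predI by metis
qed

section \<open>The core of a bounded set\<close>

text \<open>Agrees with \<open>label\<close> except at \<open>bot\<close>, where the label is empty
  and the ideal is the singleton of \<open>e bot\<close>.\<close>

definition ideal :: "'a \<Rightarrow> nat set" where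
  "ideal p = e ` {k \<in> carrier. k \<sqsubseteq> p}"

definition bounded :: "nat set \<Rightarrow> bool" where
  "bounded x \<longleftrightarrow> (\<exists>u\<in>carrier. x \<subseteq> ideal u)"

definition lub :: "nat set \<Rightarrow> 'a" where
  "lub x = (SOME t. t \<in> carrier \<and> x \<subseteq> ideal t \<and> (\<forall>u\<in>carrier. x \<subseteq> ideal u \<longrightarrow> t \<sqsubseteq> u))"

text \<open>A point of color 1 may be the value only at its own label; any other set with that
  \<open>lub\<close> is sent one step down, to color 0. Comparing with \<open>ideal\<close> is
  comparing with the label, since \<open>lub x\<close> is not \<open>bot\<close> when its color is
  1.\<close>

definition core :: "nat set \<Rightarrow> 'a" where
  "core x = (if col P (lub x) \<and> x \<noteq> ideal (lub x) then pred (lub x) else lub x)"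

section \<open>Labels and principal ideals\<close>

lemma label_eq_ideal: "p \<noteq> bot \<Longrightarrow> label P e p = ideal p"
  unfolding label_def ideal_def by simp

lemma label_subset_ideal: "label P e p \<subseteq> ideal p"
  unfolding label_def ideal_def by simp

lemma ideal_mono: "p \<sqsubseteq> q \<Longrightarrow> ideal p \<subseteq> ideal q"
  unfolding ideal_def using le_trans by blast

lemma mem_ideal_iff: "p \<in> carrier \<Longrightarrow> e p \<in> ideal q \<longleftrightarrow> p \<sqsubseteq> q"
  unfolding ideal_def using inj by (auto dest: inj_onD)

lemma label_mono:
  assumes "p \<sqsubseteq> q"
  shows "label P e p \<subseteq> label P e q"
proof (cases "p = bot")
  case True
  then show ?thesis by (simp add: label_def)
next
  case False
  then have "q \<noteq> bot" using assms bot_least le_antisym le_carrier by blast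
  then show ?thesis using False assms ideal_mono by (simp add: label_eq_ideal)
qed

text \<open>For \<open>p\<close> other than \<open>bot\<close>, the number \<open>e p\<close> is in
  the label and witnesses \<open>p \<sqsubseteq> q\<close> once it lies in \<open>ideal q\<close>;
  for \<open>bot\<close> both sides hold.\<close>

lemma label_subset_ideal_iff:
  assumes "p \<in> carrier" "q \<in> carrier"
  shows "label P e p \<subseteq> ideal q \<longleftrightarrow> p \<sqsubseteq> q"
proof (cases "p = bot")
  case True
  then show ?thesis using assms bot_least by (simp add: label_def)
next
  case False
  then show ?thesis
    using assms ideal_mono mem_ideal_iff le_refl by (metis label_eq_ideal subsetD)
qed

lemma label_inj:
  assumes "p \<in> carrier" "q \<in> carrier" "label P e p = label P e q"
  shows "p = q"
  using assms label_subset_ideal_iff label_subset_ideal le_antisym by metis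

lemma label_mem_A_set: "p \<in> carrier \<Longrightarrow> label P e p \<in> A_set P e \<longleftrightarrow> col P p"
  unfolding A_set_def using label_inj by blast

section \<open>Bounded sets, their suprema and cores\<close>

lemma bounded_subset: "bounded y \<Longrightarrow> x \<subseteq> y \<Longrightarrow> bounded x"
  unfolding bounded_def by blast

lemma bounded_finite: "bounded x \<Longrightarrow> finite x"
  unfolding bounded_def ideal_def using finite_ideal by (meson finite_imageI finite_subset)

lemma bounded_label: "p \<in> carrier \<Longrightarrow> bounded (label P e p)"
  unfolding bounded_def using label_subset_ideal by blast

text \<open>The inclusion \<open>x \<subseteq> ideal v\<close> says that \<open>v\<close> bounds all
  points numbered by \<open>x\<close>, so bounded completeness supplies the least such
  \<open>v\<close>.\<close>

lemma lub:
  assumes "bounded x"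
  shows "lub x \<in> carrier" "x \<subseteq> ideal (lub x)"
    "\<And>u. u \<in> carrier \<Longrightarrow> x \<subseteq> ideal u \<Longrightarrow> lub x \<sqsubseteq> u"
proof -
  obtain u where u: "u \<in> carrier" "x \<subseteq> ideal u" using assms unfolding bounded_def by blast
  define X where "X = {k \<in> carrier. e k \<in> x}"
  have X: "x \<subseteq> ideal v \<longleftrightarrow> (\<forall>k\<in>X. k \<sqsubseteq> v)" if "v \<in> carrier" for v
  proof
    assume "x \<subseteq> ideal v"
    then show "\<forall>k\<in>X. k \<sqsubseteq> v" using mem_ideal_iff unfolding X_def by blast
  next
    assume "\<forall>k\<in>X. k \<sqsubseteq> v"
    \<comment> \<open>The bound \<open>u\<close> ensures that every number in \<open>x\<close>
      belongs to a point, so the points in \<open>X\<close> account for all of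
      \<open>x\<close>.\<close>
    then show "x \<subseteq> ideal v" using u(2) unfolding X_def ideal_def by blast
  qed
  obtain s where s: "s \<in> carrier" "\<And>k. k \<in> X \<Longrightarrow> k \<sqsubseteq> s"
    "\<And>v. v \<in> carrier \<Longrightarrow> (\<And>k. k \<in> X \<Longrightarrow> k \<sqsubseteq> v) \<Longrightarrow> s \<sqsubseteq> v"
    using supremum_exists[of X u] u X unfolding X_def by blast
  have "s \<in> carrier \<and> x \<subseteq> ideal s \<and> (\<forall>u\<in>carrier. x \<subseteq> ideal u \<longrightarrow> s \<sqsubseteq> u)"
    using s X by blast
  then have "lub x \<in> carrier \<and> x \<subseteq> ideal (lub x) \<and> (\<forall>u\<in>carrier. x \<subseteq> ideal u \<longrightarrow> lub x \<sqsubseteq> u)"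
    unfolding lub_def
    by (rule someI[where P = "\<lambda>t. t \<in> carrier \<and> x \<subseteq> ideal t \<and> (\<forall>u\<in>carrier. x \<subseteq> ideal u \<longrightarrow> t \<sqsubseteq> u)"])
  then show "lub x \<in> carrier" "x \<subseteq> ideal (lub x)"
    "\<And>u. u \<in> carrier \<Longrightarrow> x \<subseteq> ideal u \<Longrightarrow> lub x \<sqsubseteq> u" by blast+
qed

lemma lub_mono:
  assumes "bounded y" "x \<subseteq> y"
  shows "lub x \<sqsubseteq> lub y"
  using lub(3)[OF bounded_subset[OF assms]] lub[OF assms(1)] assms(2) by blast

lemma lub_label: "p \<in> carrier \<Longrightarrow> lub (label P e p) = p"
  by (meson bounded_label lub label_subset_ideal label_subset_ideal_iff le_antisym)

lemma core_carrier: "bounded x \<Longrightarrow> core x \<in> carrier"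
  unfolding core_def using lub pred by auto

lemma core_label: "p \<in> carrier \<Longrightarrow> core (label P e p) = p"
  unfolding core_def using lub_label col_bot label_eq_ideal by metis

text \<open>The delicate case is that \<open>y\<close> is sent to \<open>pred (lub y)\<close>. If
  \<open>lub x\<close> is strictly below \<open>lub y\<close>, it is already below that predecessor;
  if they are equal, both sets step down together.\<close>

lemma core_mono:
  assumes "bounded y" "x \<subseteq> y"
  shows "core x \<sqsubseteq> core y"
proof -
  have x: "bounded x" using assms bounded_subset by blast
  have le: "lub x \<sqsubseteq> lub y" using assms by (rule lub_mono)
  have core_le: "core x \<sqsubseteq> lub x"
    unfolding core_def using lub(1)[OF x] pred(2) le_refl by auto
  show ?thesis
  proof (cases "col P (lub y) \<and> y \<noteq> ideal (lub y)")
    case False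
    then have "core y = lub y" unfolding core_def by (rule if_not_P)
    then show ?thesis using core_le le le_trans by simp
  next
    case True
    note py = pred[OF conjunct1[OF True] lub(1)[OF assms(1)]]
    have core_y: "core y = pred (lub y)" using True unfolding core_def by simp
    show ?thesis
    proof (cases "lub x = lub y")
      case True': True
      \<comment> \<open>\<open>x\<close> is contained in \<open>y\<close>, a proper subset of the
        common ideal.\<close>
      then have "x \<noteq> ideal (lub x)" using True assms lub(2)[OF assms(1)] by auto
      then show ?thesis using True True' core_y py(1) le_refl unfolding core_def by simp
    next
      case False
      then show ?thesis using py(4)[OF le] core_le le_trans core_y by simp
    qed
  qed
qed

text \<open>Predecessors have color 0, so color 1 occurs only without stepping down, that is, when
  \<open>x\<close> is the ideal and hence the label of \<open>lub x\<close>.\<close>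

lemma col_core_iff:
  assumes "bounded x"
  shows "col P (core x) \<longleftrightarrow> x \<in> A_set P e"
proof
  assume c: "col P (core x)"
  then have "col P (lub x)" "x = ideal (lub x)"
    using pred(3) lub(1)[OF assms] unfolding core_def by (auto split: if_splits)
  moreover from this have "label P e (lub x) = x" using label_eq_ideal col_bot by metis
  ultimately show "x \<in> A_set P e" using label_mem_A_set lub(1)[OF assms] by metis
next
  assume "x \<in> A_set P e"
  then show "col P (core x)" unfolding A_set_def using core_label by auto
qed

lemma A_set_bounded: "x \<in> A_set P e \<Longrightarrow> bounded x"
  unfolding A_set_def using bounded_label by blast

section \<open>Openness of the unbounded sets and the complexity of \<open>A_set\<close>\<close>

text \<open>Ascending chains terminate, so if all finite subsets of \<open>x\<close> were bounded,
  one of them would have a maximal \<open>lub\<close>. Adjoining a further element of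
  \<open>x\<close> could not raise it, so its ideal would contain all of \<open>x\<close>.\<close>

lemma unbounded_finite_subset:
  assumes "\<not> bounded x"
  obtains F where "finite F" "F \<subseteq> x" "\<not> bounded F"
proof (rule ccontr)
  assume "\<not> thesis"
  with that have bnd: "bounded F" if "finite F" "F \<subseteq> x" for F using \<open>finite F\<close> \<open>F \<subseteq> x\<close> by blast
  define S where "S = lub ` {F. finite F \<and> F \<subseteq> x}"
  have "lub {} \<in> S" "S \<subseteq> carrier" using bnd lub(1) unfolding S_def by auto
  then obtain m where m: "m \<in> S" "\<And>r. r \<in> S \<Longrightarrow> m \<sqsubseteq> r \<Longrightarrow> r = m"
    using exists_maximal by blast
  then obtain F where F: "finite F" "F \<subseteq> x" "m = lub F" unfolding S_def by blast
  have "n \<in> ideal m" if "n \<in> x" for n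
  proof -
    have G: "finite (insert n F)" "insert n F \<subseteq> x" using F that by auto
    then have "lub (insert n F) \<in> S" unfolding S_def by blast
    then have "lub (insert n F) = m" using m(2) F(3) lub_mono[OF bnd[OF G]] by blast
    then show ?thesis using lub(2)[OF bnd[OF G]] by blast
  qed
  then have "bounded x" unfolding bounded_def using m(1) \<open>S \<subseteq> carrier\<close> by blast
  then show False using assms by contradiction
qed

lemma openin_unbounded: "openin scott {x. \<not> bounded x}"
  unfolding openin_scott_iff using bounded_subset unbounded_finite_subset
  by (metis (mono_tags, lifting) mem_Collect_eq subsetI)

text \<open>Bounded sets are finite, so \<open>A_set P e\<close> and the bounded part of its
  complement consist of finite sets; the rest of the complement is open.\<close>

lemma A_set_Delta02: "A_set P e \<in> Delta02"
proof -
  have "A_set P e \<in> Sigma02"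
    using A_set_bounded bounded_finite by (blast intro: Sigma02_finite_sets)
  moreover have "{x. bounded x \<and> x \<notin> A_set P e} \<in> Sigma02"
    using bounded_finite by (blast intro: Sigma02_finite_sets)
  then have "{x. bounded x \<and> x \<notin> A_set P e} \<union> {x. \<not> bounded x} \<in> Sigma02"
    using Sigma02_Un Sigma02_openI openin_unbounded by blast
  moreover have "{x. bounded x \<and> x \<notin> A_set P e} \<union> {x. \<not> bounded x} = - A_set P e"
    using A_set_bounded by blast
  ultimately show ?thesis unfolding Delta02_def Pi02_def by simp
qed

end

section \<open>The embedding\<close>

lemma identification_lay_poset: "P \<in> P_lay \<Longrightarrow> identification P e \<Longrightarrow> lay_poset P e"
  unfolding identification_def bij_betw_def by unfold_locales auto

lemma hom_le_iff_wadge_le: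
  assumes "P \<in> P_lay" "Q \<in> P_lay" "identification P e" "identification Q d"
  shows "P \<preceq>\<^sub>c Q \<longleftrightarrow> A_set P e \<le>\<^sub>w A_set Q d"
proof -
  interpret P: lay_poset P e using assms by (blast intro: identification_lay_poset)
  interpret Q: lay_poset Q d using assms by (blast intro: identification_lay_poset)
  show ?thesis
  proof
    assume "P \<preceq>\<^sub>c Q"
    then obtain \<phi> where \<phi>: "is_hom P Q \<phi>" unfolding hom_le_def by blast
    \<comment> \<open>The value \<open>UNIV\<close> contains all others, so \<open>f\<close> stays
      monotone, and it is infinite, so it lies outside \<open>A_set Q d\<close>.\<close>
    define f where "f x = (if P.bounded x then label Q d (\<phi> (P.core x)) else UNIV)" for x
    have "f x \<subseteq> f y" if "x \<subseteq> y" for x y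
    proof (cases "P.bounded y")
      case True
      then have "label Q d (\<phi> (P.core x)) \<subseteq> label Q d (\<phi> (P.core y))"
        using P.core_mono that \<phi> unfolding is_hom_def by (intro Q.label_mono) blast
      then show ?thesis using True P.bounded_subset that unfolding f_def by simp
    next
      case False
      then show ?thesis unfolding f_def by simp
    qed
    moreover have "\<exists>F. finite F \<and> F \<subseteq> x \<and> f F = f x" for x
    proof (cases "P.bounded x")
      case True
      then show ?thesis using P.bounded_finite by blast
    next
      case False
      then obtain F where "finite F" "F \<subseteq> x" "\<not> P.bounded F"
        by (rule P.unbounded_finite_subset)
      then show ?thesis using False by (intro exI[of _ F]) (simp add: f_def)
    qed
    ultimately have "continuous_map scott scott f" by (rule continuous_map_scottI)
    moreover have "f x \<in> A_set Q d \<longleftrightarrow> x \<in> A_set P e" for x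
    proof (cases "P.bounded x")
      case True
      then have c: "P.core x \<in> elems P" by (rule P.core_carrier)
      then have "f x \<in> A_set Q d \<longleftrightarrow> col P (P.core x)"
        using True \<phi> Q.label_mem_A_set unfolding f_def is_hom_def by auto
      then show ?thesis using P.col_core_iff[OF True] by simp
    next
      case False
      then have "f x \<notin> A_set Q d"
        using Q.A_set_bounded Q.bounded_finite unfolding f_def by auto
      then show ?thesis using False P.A_set_bounded by blast
    qed
    then have "f -` A_set Q d = A_set P e" by auto
    ultimately show "A_set P e \<le>\<^sub>w A_set Q d" unfolding wadge_le_def by blast
  next
    assume "A_set P e \<le>\<^sub>w A_set Q d"
    then obtain f where f: "continuous_map scott scott f" "f -` A_set Q d = A_set P e"
      unfolding wadge_le_def by blast
    have f_iff: "f x \<in> A_set Q d \<longleftrightarrow> x \<in> A_set P e" for x using f(2) by auto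
    have bnd: "Q.bounded (f (label P e p))" if p: "p \<in> elems P" for p
    proof -
      \<comment> \<open>A point \<open>q\<close> of color 1 above \<open>p\<close> has its label in
        \<open>A_set P e\<close>, so \<open>f\<close> is bounded there; by monotonicity the value at
        the label of \<open>p\<close> is a subset.\<close>
      obtain q where q: "(p, q) \<in> leq P" "col P q" using P.exists_col_above[OF p] by blast
      then have "f (label P e q) \<in> A_set Q d"
        using f_iff P.label_mem_A_set P.le_carrier by blast
      then show ?thesis
        using Q.A_set_bounded Q.bounded_subset continuous_map_scott_mono[OF f(1)] P.label_mono q
        by blast
    qed
    have "is_hom P Q (\<lambda>p. Q.core (f (label P e p)))"
      unfolding is_hom_def
    proof (intro conjI ballI allI impI)
      fix p assume p: "p \<in> elems P"
      show "Q.core (f (label P e p)) \<in> elems Q" using bnd[OF p] by (rule Q.core_carrier)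
      show "col Q (Q.core (f (label P e p))) = col P p"
        using Q.col_core_iff[OF bnd[OF p]] f_iff P.label_mem_A_set[OF p] by simp
    next
      fix p p' assume "(p, p') \<in> leq P"
      then show "(Q.core (f (label P e p)), Q.core (f (label P e p'))) \<in> leq Q"
        using Q.core_mono bnd P.le_carrier continuous_map_scott_mono[OF f(1)] P.label_mono
        by meson
    qed
    then show "P \<preceq>\<^sub>c Q" unfolding hom_le_def by blast
  qed
qed

section \<open>Passage to the quotients\<close>

lemma identification_exists:
  assumes "P \<in> P_lay"
  obtains e where "identification P e"
proof -
  have "countable (elems P)" using assms unfolding P_lay_def shrub_def by simp
  then show ?thesis
    by (rule countable_enum_cases) (use that identification_def in blast)+
qed

lemma equiv_lay_equiv: "equiv P_lay lay_equiv"
proof (rule equivI)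
  show "trans lay_equiv"
    unfolding lay_equiv_def hom_eq_def by (rule transI) (auto intro: hom_le_trans)
qed (use hom_eq_refl in \<open>auto simp: lay_equiv_def refl_on_def sym_def hom_eq_def\<close>)

lemma equiv_delta_equiv: "equiv Delta02 delta_equiv"
proof (rule equivI)
  show "trans delta_equiv"
    unfolding delta_equiv_def wadge_eq_def by (rule transI) (auto intro: wadge_le_trans)
qed (use wadge_eq_refl in \<open>auto simp: delta_equiv_def refl_on_def sym_def wadge_eq_def\<close>)

text \<open>Homomorphisms compose, so a relation between some representatives transfers to the given
  ones.\<close>

lemma lay_class_le_iff:
  fixes P Q :: "'a cposet"
  assumes "P \<in> P_lay" "Q \<in> P_lay"
  shows "lay_class_le (lay_equiv `` {P}) (lay_equiv `` {Q}) \<longleftrightarrow> P \<preceq>\<^sub>c Q"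
proof
  assume "lay_class_le (lay_equiv `` {P}) (lay_equiv `` {Q})"
  then obtain P' Q' :: "'a cposet" where "P \<equiv>\<^sub>c P'" "P' \<preceq>\<^sub>c Q'" "Q \<equiv>\<^sub>c Q'"
    unfolding lay_class_le_def lay_equiv_def by auto
  then show "P \<preceq>\<^sub>c Q" unfolding hom_eq_def by (meson hom_le_trans)
next
  assume "P \<preceq>\<^sub>c Q"
  then show "lay_class_le (lay_equiv `` {P}) (lay_equiv `` {Q})"
    using assms equiv_class_self[OF equiv_lay_equiv] unfolding lay_class_le_def by blast
qed

lemma delta_class_le_iff:
  assumes "A \<in> Delta02" "B \<in> Delta02"
  shows "delta_class_le (delta_equiv `` {A}) (delta_equiv `` {B}) \<longleftrightarrow> A \<le>\<^sub>w B"
proof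
  assume "delta_class_le (delta_equiv `` {A}) (delta_equiv `` {B})"
  then obtain A' B' where "A \<equiv>\<^sub>w A'" "A' \<le>\<^sub>w B'" "B \<equiv>\<^sub>w B'"
    unfolding delta_class_le_def delta_equiv_def by auto
  then show "A \<le>\<^sub>w B" unfolding wadge_eq_def by (meson wadge_le_trans)
next
  assume "A \<le>\<^sub>w B"
  then show "delta_class_le (delta_equiv `` {A}) (delta_equiv `` {B})"
    using assms equiv_class_self[OF equiv_delta_equiv] unfolding delta_class_le_def by blast
qed

text \<open>Taking \<open>P\<close> and \<open>Q\<close> equal in the second conjunct shows that the
  Wadge degree of \<open>A_set P e\<close> is independent of \<open>e\<close>. As both class orders
  are antisymmetric, the last equivalence also makes \<open>\<Phi>\<close> injective on
  classes.\<close>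

theorem theorem26:
  shows "(\<forall>P \<in> (P_lay :: 'a cposet set). \<forall>e. identification P e \<longrightarrow> A_set P e \<in> Delta02) \<and>
    (\<forall>P \<in> (P_lay :: 'a cposet set). \<forall>Q \<in> (P_lay :: 'b cposet set). \<forall>e d.
       identification P e \<longrightarrow> identification Q d \<longrightarrow>
         (P \<preceq>\<^sub>c Q \<longleftrightarrow> A_set P e \<le>\<^sub>w A_set Q d) \<and>
         (P \<equiv>\<^sub>c Q \<longleftrightarrow> A_set P e \<equiv>\<^sub>w A_set Q d)) \<and>
    (\<exists>\<Phi> :: 'a cposet set \<Rightarrow> nat set set set.
       \<Phi> \<in> P_lay // lay_equiv \<rightarrow> Delta02 // delta_equiv \<and>
       (\<forall>P \<in> P_lay. \<forall>e. identification P e \<longrightarrow>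
          \<Phi> (lay_equiv `` {P}) = delta_equiv `` {A_set P e}) \<and>
       (\<forall>X \<in> P_lay // lay_equiv. \<forall>Y \<in> P_lay // lay_equiv.
          lay_class_le X Y \<longleftrightarrow> delta_class_le (\<Phi> X) (\<Phi> Y)))"
proof -
  note delta = lay_poset.A_set_Delta02[OF identification_lay_poset]
  define ident :: "'a cposet \<Rightarrow> 'a \<Rightarrow> nat" where "ident P = (SOME e. identification P e)" for P
  \<comment> \<open>The value is taken at an arbitrary representative with an arbitrary
    identification; \<open>\<Phi>_class\<close> shows that the outcome depends on neither.\<close>
  define \<Phi> where "\<Phi> X = delta_equiv `` {A_set (SOME P. P \<in> X) (ident (SOME P. P \<in> X))}"
    for X :: "'a cposet set"
  have ident: "identification P (ident P)" if "P \<in> P_lay" for P :: "'a cposet"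
    unfolding ident_def using identification_exists[OF that] by (metis someI)
  have \<Phi>_class: "\<Phi> (lay_equiv `` {P}) = delta_equiv `` {A_set P e}"
    if P: "P \<in> P_lay" "identification P e" for P :: "'a cposet" and e
  proof -
    define R where "R = (SOME P'. P' \<in> lay_equiv `` {P})"
    have "P \<in> lay_equiv `` {P}" using equiv_class_self[OF equiv_lay_equiv P(1)] .
    then have "R \<in> lay_equiv `` {P}" unfolding R_def by (rule someI)
    then have R: "R \<in> P_lay" "P \<equiv>\<^sub>c R" unfolding lay_equiv_def by auto
    then have "A_set P e \<equiv>\<^sub>w A_set R (ident R)"
      using P ident[OF R(1)] unfolding hom_eq_def wadge_eq_def by (simp add: hom_le_iff_wadge_le)
    then have "(A_set P e, A_set R (ident R)) \<in> delta_equiv"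
      unfolding delta_equiv_def using delta P R ident by blast
    then show ?thesis
      unfolding \<Phi>_def R_def[symmetric] using equiv_class_eq[OF equiv_delta_equiv] by blast
  qed
  have class_le: "lay_class_le X Y \<longleftrightarrow> delta_class_le (\<Phi> X) (\<Phi> Y)"
    if "X \<in> P_lay // lay_equiv" "Y \<in> P_lay // lay_equiv" for X Y
  proof -
    obtain P Q where PQ: "P \<in> P_lay" "X = lay_equiv `` {P}" "Q \<in> P_lay" "Y = lay_equiv `` {Q}"
      using \<open>X \<in> _\<close> \<open>Y \<in> _\<close> by (metis quotientE)
    then show ?thesis
      using delta[OF PQ(1) ident[OF PQ(1)]] delta[OF PQ(3) ident[OF PQ(3)]]
      by (simp add: lay_class_le_iff \<Phi>_class[OF _ ident] delta_class_le_iff hom_le_iff_wadge_le ident)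
  qed
  have "\<Phi> \<in> P_lay // lay_equiv \<rightarrow> Delta02 // delta_equiv"
  proof
    fix X :: "'a cposet set" assume "X \<in> P_lay // lay_equiv"
    then obtain P where P: "P \<in> P_lay" "X = lay_equiv `` {P}" by (rule quotientE)
    then show "\<Phi> X \<in> Delta02 // delta_equiv"
      using \<Phi>_class[OF P(1) ident] delta[OF P(1) ident] by (simp add: quotientI)
  qed
  then show ?thesis
    using delta \<Phi>_class class_le by (auto simp: hom_le_iff_wadge_le hom_eq_def wadge_eq_def)
qed

end
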